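(* Let $d\ge 1$ and suppose that the family $(A_g)_{g\in E}$ satisfies Assumptions 1)–7) listed in the context. Then the random field $\xi=(\xi(x))_{x\in\mathbb{R}^d}$, $\xi(x)=\inf_{g\in\mathcal N}A_g(x)$, is mixing; that is, writing $\mathbb{P}$ for the law of $\xi$ on $\Omega=\mathbb{R}^{\mathbb{R}^d}$ equipped with the $\sigma$-algebra $\mathcal F$ generated by the cylinders and $S_h(\omega)(x)=\omega(x+h)$ for $h\in\mathbb{R}^d$, for all $A,B\in\mathcal F$, $$\mathbb{P}(A\cap S_h^{-1}(B))\longrightarrow \mathbb{P}(A)\,\mathbb{P}(B)\quad\text{as } |h|\to\infty .$$
   Context: Notation. $\mathbb{R}^+=[0,\infty)$, $E=\mathbb{R}^d\times\mathbb{R}^+$, $|\cdot|$ is the Euclidean norm and $B(0,r)=\{x\in\mathbb{R}^d: |x|\le r\}$. A germ is a point $g=(x_g,t_g)\in E$ ($x_g$ = location, $t_g$ = birth time). $\mathcal N$ is a Poisson point process on $E$ (viewed as a random locally finite set of germs) with intensity measure $\Lambda=\lambda^d\times m$, where $\lambda^d$ is Lebesgue measure on $\mathbb{R}^d$ and $m$ is a nonzero measure on $\mathbb{R}^+$ with $m([0,a])<\infty$ for all $a>0$. To each $g\in E$ is associated a (deterministic) function $A_g:\mathbb{R}^d\to\mathbb{R}^+$; the free crystal of $g$ at time $t\ge 0$ is $C_g(t)=\{x: A_g(x)\le t\}$. The random field is $\xi(x)=\inf_{g\in\mathcal N}A_g(x)$. Assumptions. 1) For all $g=(x_g,t_g)\in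 E$ and $x\in\mathbb{R}^d$: $A_g(x)=A_{(0,t_g)}(x-x_g)$. 2) For all $g\in E$: $A_g(x_g)=t_g$ and $A_g(x)\ge t_g$ for all $x\in\mathbb{R}^d$. 3) The free crystals $C_g(t)$ are bounded convex sets, and $C_g(s)\subset C_g(t)$ for $0\le s<t$. 4) The functions $x\mapsto A_g(x)$ are continuous and $\partial C_g(t)=\{x: A_g(x)=t\}$. 5) There exists $M>0$ such that for all $t_g\in\mathbb{R}^+$ and $x\in\mathbb{R}^d$: $A_{(0,t_g)}(x)\ge t_g+\frac1M|x|$. 6) For all $g=(0,t_g)$ and all $r>0$ there exists $t>0$ with $C_g(t)\supset B(0,r)$. 7) With $L_g=\{(x,t): A_g(x)\le t\}$ the epigraph of $A_g$: for all $g\in E$ and all $g_1\in L_g$, $A_g(x)\le A_{g_1}(x)$ for all $x\in\mathbb{R}^d$. *)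

theory Defs
  imports "HOL-Probability.Probability"
begin

definition point_count :: "'e set \<Rightarrow> 'e set \<Rightarrow> ennreal" where
  "point_count S B = emeasure (count_space UNIV) (S \<inter> B)"

(* The mean may be 0 or infinite (Poisson(\<infinity>) is the point mass at \<infinity>), which poisson_pmf
   does not cover; for mean 0 the formula below gives the point mass at 0, as 0 ^ 0 = 1. *)
definition poisson_distributed :: "'w measure \<Rightarrow> ennreal \<Rightarrow> ('w \<Rightarrow> ennreal) \<Rightarrow> bool" where
  "poisson_distributed M r X \<longleftrightarrow>
     X \<in> borel_measurable M \<and>
     (if r = \<infinity> then AE \<omega> in M. X \<omega> = \<infinity>
      else \<forall>k::nat. measure M {\<omega> \<in> space M. X \<omega> = of_nat k}
             = enn2real r ^ k / fact k * exp (- enn2real r))"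

definition poisson_point_process ::
  "'w measure \<Rightarrow> 'e::topological_space measure \<Rightarrow> ('w \<Rightarrow> 'e set) \<Rightarrow> bool" where
  "poisson_point_process M \<Lambda> N \<longleftrightarrow>
     prob_space M \<and>
     (\<forall>\<omega>\<in>space M. N \<omega> \<subseteq> space \<Lambda> \<and> (\<forall>K. compact K \<longrightarrow> finite (N \<omega> \<inter> K))) \<and>
     (\<forall>B\<in>sets \<Lambda>. poisson_distributed M (emeasure \<Lambda> B) (\<lambda>\<omega>. point_count (N \<omega>) B)) \<and>
     (\<forall>(I::nat set) B. finite I \<and> (\<forall>i\<in>I. B i \<in> sets \<Lambda>) \<and> disjoint_family_on B I \<longrightarrow>
        prob_space.indep_vars M (\<lambda>_. borel) (\<lambda>i \<omega>. point_count (N \<omega>) (B i)) I)"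

(* Germs g = (x_g, t_g): fst g is the location, snd g the birth time. *)
definition germ_space :: "((real ^ 'd) \<times> real) set" where
  "germ_space = UNIV \<times> {0..}"

definition free_crystal ::
  "((real ^ 'd) \<times> real \<Rightarrow> real ^ 'd \<Rightarrow> real) \<Rightarrow> (real ^ 'd) \<times> real \<Rightarrow> real \<Rightarrow> (real ^ 'd) set" where
  "free_crystal A g t = {x. A g x \<le> t}"

(* Inf is the infimum of real numbers. It has no meaning for N \<omega> = {}, an event of probability 0
   when the process has infinite total intensity. *)
definition crystal_field ::
  "((real ^ 'd) \<times> real \<Rightarrow> real ^ 'd \<Rightarrow> real) \<Rightarrow> ('w \<Rightarrow> ((real ^ 'd) \<times> real) set)
     \<Rightarrow> 'w \<Rightarrow> real ^ 'd \<Rightarrow> real" where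
  "crystal_field A N \<omega> x = (INF g\<in>N \<omega>. A g x)"

abbreviation field_algebra :: "('a \<Rightarrow> real) measure" where
  "field_algebra \<equiv> PiM UNIV (\<lambda>_. borel)"

definition field_shift :: "'a::plus \<Rightarrow> ('a \<Rightarrow> real) \<Rightarrow> 'a \<Rightarrow> real" where
  "field_shift h f = (\<lambda>x. f (x + h))"

(* Measurability is included because distr is only the law of X for measurable X. *)
definition mixing_field :: "'w measure \<Rightarrow> ('w \<Rightarrow> 'a::real_normed_vector \<Rightarrow> real) \<Rightarrow> bool" where
  "mixing_field M X \<longleftrightarrow>
     X \<in> measurable M field_algebra \<and>
     (let P = distr M field_algebra X in
      \<forall>A\<in>sets field_algebra. \<forall>B\<in>sets field_algebra.
        ((\<lambda>h. measure P (A \<inter> field_shift h -` B)) \<longlongrightarrow> measure P A * measure P B) at_infinity)"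

end

theory Submission
  imports Defs
begin

text \<open>
  The event that \<open>\<xi> x \<ge> t\<close> for all \<open>(x, t)\<close> in a finite set \<open>F\<close> says, up to a null set, that no germ
  of the process lies in \<open>D F = {g. \<exists>(x, t)\<in>F. A g x < t}\<close>, so it has probability
  \<open>exp (- \<Lambda> (D F))\<close>. Linear growth (A5) makes \<open>D F\<close> bounded, hence \<open>D F\<close> is disjoint from the
  translate of \<open>D F'\<close> by \<open>h\<close> for large \<open>h\<close>; as \<open>\<Lambda>\<close> is additive and invariant under translations in
  space, events of this form are then exactly independent. They form a generating \<open>\<pi>\<close>-system, and
  mixing extends from it to the whole \<open>\<sigma>\<close>-algebra by Dynkin's argument, where dominated convergence
  of series handles countable disjoint unions.
\<close>

section \<open>Mixing from a generating pi-system\<close>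

text \<open>Events on which \<open>T\<close> preserves probability form a Dynkin system, because
  preimages commute with complements and disjoint unions. Invariance on all events supplies the
  dominating sequence in \<open>mixing_from_pi_system\<close>.\<close>

lemma (in prob_space) shift_invariant_from_pi_system:
  assumes G: "Int_stable G" "G \<subseteq> Pow (space M)" "sets M = sigma_sets (space M) G"
    and T: "T \<in> measurable M M"
    and inv: "\<And>B. B \<in> G \<Longrightarrow> prob (T -` B \<inter> space M) = prob B"
    and B: "B \<in> sets M"
  shows "prob (T -` B \<inter> space M) = prob B"
proof -
  have vim: "T -` X \<inter> space M \<in> events" if "X \<in> sigma_sets (space M) G" for X
    using T G(3) that by (auto intro: measurable_sets)
  have "B \<in> sigma_sets (space M) G" using B G(3) by simp
  with G(1,2) show ?thesis
  proof (induction rule: sigma_sets_induct_disjoint)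
    case (compl X)
    have "T -` (space M - X) \<inter> space M = space M - (T -` X \<inter> space M)"
      using measurable_space[OF T] by auto
    then show ?case
      using compl(2) prob_compl[OF vim[OF compl(1)]] prob_compl[of X] compl(1) G(3) by metis
  next
    case (union X)
    have ev: "range X \<subseteq> events" using union(2) G(3) by auto
    have "(\<lambda>i. prob (T -` X i \<inter> space M)) sums prob (\<Union>i. T -` X i \<inter> space M)"
      using union(1,2) vim
      by (intro finite_measure_UNION) (auto simp: disjoint_family_on_def image_subset_iff)
    moreover have "(\<lambda>i. prob (X i)) sums prob (\<Union>i. X i)"
      using ev union(1) by (intro finite_measure_UNION)
    moreover have "(\<Union>i. T -` X i \<inter> space M) = T -` (\<Union>i. X i) \<inter> space M" by auto
    ultimately show ?case using union(3) sums_unique2 by fastforce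
  qed (use inv in auto)
qed

text \<open>Tannery's theorem, dominated convergence for series: the bound \<open>c i\<close> does
  not depend on \<open>h\<close>, so the limit may be taken inside the sum over
  \<open>i\<close>.\<close>

lemma (in prob_space) tendsto_prob_disjoint_UN:
  fixes X :: "nat \<Rightarrow> 'b \<Rightarrow> 'a set"
  assumes F: "F \<noteq> bot"
    and ev: "\<And>i h. X i h \<in> events"
    and disj: "\<And>h. disjoint_family (\<lambda>i. X i h)"
    and bound: "\<And>i h. prob (X i h) \<le> c i" and c: "summable c"
    and lim: "\<And>i. ((\<lambda>h. prob (X i h)) \<longlongrightarrow> l i) F"
  shows "((\<lambda>h. prob (\<Union>i. X i h)) \<longlongrightarrow> (\<Sum>i. l i)) F"
proof -
  have "\<forall>\<^sub>F (i, h) in at_top \<times>\<^sub>F F. norm (prob (X i h)) \<le> c i"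
    using bound by (intro always_eventually) auto
  then have "((\<lambda>h. \<Sum>i. prob (X i h)) \<longlongrightarrow> (\<Sum>i. l i)) F"
    using tannerys_theorem[where a = "\<lambda>i h. prob (X i h)", OF lim _ c F] by blast
  moreover have "(\<Sum>i. prob (X i h)) = prob (\<Union>i. X i h)" for h
    using ev disj by (intro sums_unique[symmetric] finite_measure_UNION) auto
  ultimately show ?thesis by simp
qed

text \<open>Two Dynkin inductions, one per argument: \<open>B\<close> becomes arbitrary while
  \<open>A\<close> stays in \<open>G\<close>, then \<open>A\<close> is released. Complements pass by
  subtraction, disjoint unions by dominated convergence.\<close>

lemma (in prob_space) mixing_from_pi_system:
  assumes F: "F \<noteq> bot"
    and G: "Int_stable G" "G \<subseteq> Pow (space M)" "sets M = sigma_sets (space M) G"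
    and T: "\<And>h. T h \<in> measurable M M"
    and inv: "\<And>h B. B \<in> G \<Longrightarrow> prob (T h -` B \<inter> space M) = prob B"
    and mix: "\<And>A B. A \<in> G \<Longrightarrow> B \<in> G \<Longrightarrow>
      ((\<lambda>h. prob (A \<inter> (T h -` B \<inter> space M))) \<longlongrightarrow> prob A * prob B) F"
    and A: "A \<in> sets M" and B: "B \<in> sets M"
  shows "((\<lambda>h. prob (A \<inter> (T h -` B \<inter> space M))) \<longlongrightarrow> prob A * prob B) F"
proof -
  have vim [measurable]: "T h -` X \<inter> space M \<in> events" if "X \<in> events" for X h
    using T that by (rule measurable_sets)
  have inv': "prob (T h -` X \<inter> space M) = prob X" if "X \<in> events" for X h
    using shift_invariant_from_pi_system[OF G T inv that] .
  have G_ev: "X \<in> events" if "X \<in> G" for X using that G(3) by auto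
  have one: "((\<lambda>h. prob (A \<inter> (T h -` B \<inter> space M))) \<longlongrightarrow> prob A * prob B) F" if A: "A \<in> G" for A
  proof -
    note [measurable] = G_ev[OF A]
    have "B \<in> sigma_sets (space M) G" using B G(3) by simp
    with G(1,2) show ?thesis
    proof (induction rule: sigma_sets_induct_disjoint)
      case (compl X)
      have X [measurable]: "X \<in> events" using compl G(3) by simp
      have "A \<inter> (T h -` (space M - X) \<inter> space M) = A - A \<inter> (T h -` X \<inter> space M)" for h
        using measurable_space[OF T] sets.sets_into_space[OF G_ev[OF A]] by auto
      then have "prob (A \<inter> (T h -` (space M - X) \<inter> space M))
          = prob A - prob (A \<inter> (T h -` X \<inter> space M))" for h
        by (simp add: finite_measure_Diff)
      then show ?case
        using tendsto_diff[OF tendsto_const compl(2), of "prob A"]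
        by (simp add: prob_compl right_diff_distrib)
    next
      case (union X)
      have X [measurable]: "X i \<in> events" for i using union(2) G(3) by auto
      have s: "(\<lambda>i. prob (X i)) sums prob (\<Union>i. X i)"
        using union(1) by (intro finite_measure_UNION) auto
      have "((\<lambda>h. prob (\<Union>i. A \<inter> (T h -` X i \<inter> space M))) \<longlongrightarrow> (\<Sum>i. prob A * prob (X i))) F"
      proof (rule tendsto_prob_disjoint_UN[OF F, where c = "\<lambda>i. prob (X i)"])
        show "disjoint_family (\<lambda>i. A \<inter> (T h -` X i \<inter> space M))" for h
          using union(1) by (auto simp: disjoint_family_on_def)
        \<comment> \<open>Invariance gives the dominating term \<open>prob (X i)\<close>, free of
          \<open>h\<close> and summable because the \<open>X i\<close> are disjoint.\<close>
        show "prob (A \<inter> (T h -` X i \<inter> space M)) \<le> prob (X i)" for i h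
          unfolding inv'[OF X, symmetric, of i h] by (intro finite_measure_mono) auto
      qed (use s union(3) in \<open>auto intro: sums_summable\<close>)
      moreover have "(\<Union>i. A \<inter> (T h -` X i \<inter> space M)) = A \<inter> (T h -` (\<Union>i. X i) \<inter> space M)" for h
        by auto
      moreover have "(\<Sum>i. prob A * prob (X i)) = prob A * prob (\<Union>i. X i)"
        using sums_mult[OF s] by (rule sums_unique[symmetric])
      ultimately show ?case by simp
    qed (use mix A in auto)
  qed
  have "A \<in> sigma_sets (space M) G" using A G(3) by simp
  note [measurable] = B
  from G(1,2) \<open>A \<in> sigma_sets (space M) G\<close> show ?thesis
  proof (induction rule: sigma_sets_induct_disjoint)
    case empty
    then show ?case by simp
  next
    case (compl X)
    have X [measurable]: "X \<in> events" using compl G(3) by simp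
    have "(space M - X) \<inter> (T h -` B \<inter> space M) = (T h -` B \<inter> space M) - X \<inter> (T h -` B \<inter> space M)" for h
      by auto
    \<comment> \<open>The difference is taken inside the preimage of \<open>B\<close>, whose
      probability is \<open>prob B\<close> by invariance.\<close>
    moreover have "prob ((T h -` B \<inter> space M) - X \<inter> (T h -` B \<inter> space M))
        = prob B - prob (X \<inter> (T h -` B \<inter> space M))" for h
      using B by (subst finite_measure_Diff) (auto simp: inv' vim)
    ultimately have "prob ((space M - X) \<inter> (T h -` B \<inter> space M))
        = prob B - prob (X \<inter> (T h -` B \<inter> space M))" for h
      by simp
    then show ?case
      using tendsto_diff[OF tendsto_const compl(2), of "prob B"]
      by (simp add: prob_compl left_diff_distrib)
  next
    case (union X)
    have X [measurable]: "X i \<in> events" for i using union(2) G(3) by auto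
    have s: "(\<lambda>i. prob (X i)) sums prob (\<Union>i. X i)"
      using union(1) by (intro finite_measure_UNION) auto
    have "((\<lambda>h. prob (\<Union>i. X i \<inter> (T h -` B \<inter> space M))) \<longlongrightarrow> (\<Sum>i. prob (X i) * prob B)) F"
    proof (rule tendsto_prob_disjoint_UN[OF F, where c = "\<lambda>i. prob (X i)"])
      show "disjoint_family (\<lambda>i. X i \<inter> (T h -` B \<inter> space M))" for h
        using union(1) by (auto simp: disjoint_family_on_def)
      show "prob (X i \<inter> (T h -` B \<inter> space M)) \<le> prob (X i)" for i h
        by (intro finite_measure_mono) auto
    qed (use s union(3) B in \<open>auto intro: sums_summable\<close>)
    moreover have "(\<Union>i. X i \<inter> (T h -` B \<inter> space M)) = (\<Union>i. X i) \<inter> (T h -` B \<inter> space M)" for h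
      by auto
    moreover have "(\<Sum>i. prob (X i) * prob B) = prob (\<Union>i. X i) * prob B"
      using sums_mult2[OF s] by (rule sums_unique[symmetric])
    ultimately show ?case by simp
  qed (use one in auto)
qed

section \<open>Upper orthants generate the cylinder algebra\<close>

text \<open>Points and thresholds form a relation, not a function: one point may carry several
  thresholds, so that intersecting orthants amounts to uniting index sets.\<close>

definition upper_orthant :: "('a \<times> real) set \<Rightarrow> ('a \<Rightarrow> real) set" where
  "upper_orthant F = {f. \<forall>p\<in>F. snd p \<le> f (fst p)}"

lemma upper_orthant_Un: "upper_orthant (F \<union> F') = upper_orthant F \<inter> upper_orthant F'"
  by (auto simp: upper_orthant_def)

lemma Int_stable_upper_orthants:
  "Int_stable (upper_orthant ` Collect finite :: ('a \<Rightarrow> real) set set)"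
proof (rule Int_stableI)
  fix X Y :: "('a \<Rightarrow> real) set"
  assume "X \<in> upper_orthant ` Collect finite" "Y \<in> upper_orthant ` Collect finite"
  then obtain F F' where "finite F" "finite F'" "X = upper_orthant F" "Y = upper_orthant F'"
    by auto
  then have "X \<inter> Y = upper_orthant (F \<union> F')" "finite (F \<union> F')"
    by (simp_all add: upper_orthant_Un)
  then show "X \<inter> Y \<in> upper_orthant ` Collect finite" by blast
qed

lemma space_field_algebra [simp]: "space field_algebra = UNIV"
  by (simp add: space_PiM)

lemma upper_orthant_sets:
  assumes "finite F"
  shows "upper_orthant F \<in> sets field_algebra"
proof -
  have "{f \<in> space field_algebra. \<forall>p\<in>F. snd p \<le> f (fst p)} \<in> sets field_algebra"
    using assms by measurable
  then show ?thesis by (simp add: upper_orthant_def)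
qed

text \<open>Half-lines \<open>{a..}\<close> generate the Borel sets, so singletons \<open>F\<close>
  already make every coordinate measurable; larger finite \<open>F\<close> give stability under
  intersection.\<close>

lemma sets_field_algebra_eq:
  "sets (field_algebra :: ('a \<Rightarrow> real) measure) = sigma_sets UNIV (upper_orthant ` Collect finite)"
proof
  let ?G = "upper_orthant ` Collect finite :: ('a \<Rightarrow> real) set set"
  let ?S = "sigma UNIV ?G"
  have space_S: "space ?S = UNIV" by (rule space_measure_of) simp
  have sets_S: "sets ?S = sigma_sets UNIV ?G" by (rule sets_measure_of) simp
  have "(\<lambda>f. f x) \<in> borel_measurable ?S" for x :: 'a
    unfolding borel_measurable_iff_ge
  proof
    fix a
    have "{f \<in> space ?S. a \<le> f x} = upper_orthant {(x, a)}"
      by (simp add: upper_orthant_def space_S)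
    also have "\<dots> \<in> sets ?S"
      unfolding sets_S by (intro sigma_sets.Basic imageI) simp
    finally show "{f \<in> space ?S. a \<le> f x} \<in> sets ?S" .
  qed
  \<comment> \<open>Measurability of the identity between the two spaces is inclusion of their
    sigma-algebras.\<close>
  then have "(\<lambda>f x. f x) \<in> measurable ?S field_algebra"
    by (rule measurable_PiM_single') (simp add: PiE_UNIV_domain)
  then have "(\<lambda>f x. f x) -` B \<inter> space ?S \<in> sets ?S" if "B \<in> sets field_algebra" for B
    using that by (rule measurable_sets)
  then show "sets field_algebra \<subseteq> sigma_sets UNIV ?G"
    unfolding space_S sets_S by (intro subsetI) simp
  have "?G \<subseteq> sets field_algebra" using upper_orthant_sets by blast
  then show "sigma_sets UNIV ?G \<subseteq> sets field_algebra"
    using sets.sigma_sets_subset[of ?G field_algebra] by simp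
qed

lemma measurable_field_shift: "field_shift h \<in> measurable field_algebra field_algebra"
  unfolding field_shift_def
  by (rule measurable_PiM_single') (simp_all add: PiE_UNIV_domain)

lemma field_shift_vimage_upper_orthant:
  "field_shift h -` upper_orthant F = upper_orthant ((\<lambda>p. (fst p + h, snd p)) ` F)"
  by (auto simp: field_shift_def upper_orthant_def)

section \<open>Void probabilities\<close>

lemma point_count_eq_0_iff: "point_count S B = 0 \<longleftrightarrow> S \<inter> B = {}"
  by (simp add: point_count_def emeasure_count_space_eq_0)

lemma poisson_void_sets:
  assumes "poisson_point_process M \<Lambda> N" "D \<in> sets \<Lambda>"
  shows "{\<omega> \<in> space M. N \<omega> \<inter> D = {}} \<in> sets M"
proof -
  have [measurable]: "(\<lambda>\<omega>. point_count (N \<omega>) D) \<in> borel_measurable M"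
    using assms by (simp add: poisson_point_process_def poisson_distributed_def)
  have "{\<omega> \<in> space M. point_count (N \<omega>) D = 0} \<in> sets M" by measurable
  then show ?thesis by (simp add: point_count_eq_0_iff)
qed

lemma poisson_void_probability:
  assumes "poisson_point_process M \<Lambda> N" "D \<in> sets \<Lambda>" "emeasure \<Lambda> D < \<infinity>"
  shows "measure M {\<omega> \<in> space M. N \<omega> \<inter> D = {}} = exp (- measure \<Lambda> D)"
proof -
  have "measure M {\<omega> \<in> space M. point_count (N \<omega>) D = of_nat k}
      = measure \<Lambda> D ^ k / fact k * exp (- measure \<Lambda> D)" for k
    using assms unfolding poisson_point_process_def poisson_distributed_def measure_def[of \<Lambda>]
    by auto
  \<comment> \<open>At \<open>k = 0\<close> the power and the factorial are both 1.\<close>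
  from this[of 0] show ?thesis by (simp add: point_count_eq_0_iff)
qed

text \<open>A Poisson count with infinite mean is almost surely infinite. This discards the outcomes
  where the infimum runs over the empty set.\<close>

lemma poisson_AE_nonempty:
  assumes N: "poisson_point_process M \<Lambda> N" and inf: "emeasure \<Lambda> (space \<Lambda>) = \<infinity>"
  shows "AE \<omega> in M. N \<omega> \<noteq> {}"
proof -
  have "poisson_distributed M (emeasure \<Lambda> (space \<Lambda>)) (\<lambda>\<omega>. point_count (N \<omega>) (space \<Lambda>))"
    using N by (simp add: poisson_point_process_def)
  with inf have "AE \<omega> in M. point_count (N \<omega>) (space \<Lambda>) = \<infinity>"
    by (simp add: poisson_distributed_def)
  then show ?thesis by eventually_elim (auto simp: point_count_def)
qed

section \<open>Growing crystals\<close>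

text \<open>Such a set is an interval. The lemma is meant for sets of birth times, which are
  downward closed because crystals are monotone in the birth time.\<close>

lemma downward_closed_borel:
  fixes S :: "real set"
  assumes "\<And>s t. t \<in> S \<Longrightarrow> s \<le> t \<Longrightarrow> s \<in> S"
  shows "S \<in> sets borel"
  using assms by (intro real_interval_borel_measurable) (auto simp: is_interval_1)

text \<open>The ordering of crystals enters as \<open>mono\<close>, comparing two birth times at one
  location; \<open>theorem1\<close> derives it from \<open>A2\<close> and \<open>A7\<close>.\<close>

locale crystal_growth =
  fixes A :: "(real ^ 'd) \<times> real \<Rightarrow> real ^ 'd \<Rightarrow> real"
    and m :: "real measure"
    and M :: real
  assumes m_sets: "sets m = sets (restrict_space borel {0..})"
    and m_finite: "\<And>a. a > 0 \<Longrightarrow> emeasure m {0..a} < \<infinity>"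
    and m_nonzero: "emeasure m {0..} \<noteq> 0"
    and nonneg: "\<And>g x. g \<in> germ_space \<Longrightarrow> 0 \<le> A g x"
    and translate: "\<And>y s x. s \<ge> 0 \<Longrightarrow> A (y, s) x = A (0, s) (x - y)"
    and mono: "\<And>s t x. 0 \<le> s \<Longrightarrow> s \<le> t \<Longrightarrow> A (0, s) x \<le> A (0, t) x"
    and cont: "\<And>s. s \<ge> 0 \<Longrightarrow> continuous_on UNIV (A (0, s))"
    and M_pos: "M > 0"
    and growth: "\<And>t x. t \<ge> 0 \<Longrightarrow> t + 1 / M * norm x \<le> A (0, t) x"
begin

abbreviation intensity :: "((real ^ 'd) \<times> real) measure" where
  "intensity \<equiv> lborel \<Otimes>\<^sub>M m"

lemma space_m: "space m = {0..}"
  using sets_eq_imp_space_eq[OF m_sets] by (simp add: space_restrict_space)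

lemma space_intensity: "space intensity = germ_space"
  by (simp add: space_pair_measure space_m germ_space_def)

lemma borel_imp_sets_m: "S \<inter> {0..} \<in> sets m" if "S \<in> sets borel"
  using that by (auto simp: m_sets sets_restrict_space)

sublocale m: sigma_finite_measure m
proof
  \<comment> \<open>The \<open>+ 1\<close> keeps the right end positive at \<open>n = 0\<close>, as
    \<open>m_finite\<close> requires.\<close>
  let ?I = "\<lambda>n::nat. {0..real n + 1}"
  have sets: "?I n \<in> sets m" for n
    using borel_imp_sets_m[of "{0..real n + 1}"] by (simp add: inf_absorb1 Int_absorb2 subset_iff)
  have fin: "emeasure m (?I n) \<noteq> \<infinity>" for n
    using m_finite[of "real n + 1"] by simp
  have "\<exists>n. x \<le> real n + 1" for x
    using real_arch_simple[of x] by (meson add_increasing2 order_refl order_trans zero_le_one)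
  then have "(\<Union>n. ?I n) = space m" by (auto simp: space_m)
  then show "\<exists>X. countable X \<and> X \<subseteq> sets m \<and> \<Union> X = space m \<and> (\<forall>a\<in>X. emeasure m a \<noteq> \<infinity>)"
    using sets fin by (intro exI[of _ "range ?I"]) auto
qed

sublocale pair: pair_sigma_finite "lborel :: (real ^ 'd) measure" m ..

lemma emeasure_intensity_space: "emeasure intensity (space intensity) = \<infinity>"
proof -
  have "emeasure intensity (UNIV \<times> {0..}) = emeasure lborel (UNIV :: (real ^ 'd) set) * emeasure m {0..}"
    using sets.top[of m] by (intro m.emeasure_pair_measure_Times) (auto simp: space_m)
  also have "\<dots> = \<infinity>"
    using m_nonzero by (simp add: ennreal_top_mult)
  finally show ?thesis by (simp only: space_intensity germ_space_def)
qed

section \<open>Germs that pull the field strictly below a threshold of \<open>F\<close>\<close>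

definition early :: "((real ^ 'd) \<times> real) set \<Rightarrow> ((real ^ 'd) \<times> real) set" where
  "early F = {g \<in> germ_space. \<exists>p\<in>F. A g (fst p) < snd p}"

lemma early_Un: "early (F \<union> F') = early F \<union> early F'"
  by (auto simp: early_def)

lemma early_subset: "early F \<subseteq> germ_space"
  by (auto simp: early_def)

text \<open>\<open>A g x\<close> depends on the location of \<open>g\<close> only through
  \<open>x - fst g\<close>, so a shift of the observation points is matched by the same shift of the
  germs.\<close>

lemma early_shift:
  "early ((\<lambda>p. (fst p + h, snd p)) ` F) = {g \<in> germ_space. (fst g - h, snd g) \<in> early F}"
proof -
  have "A g (x + h) = A (fst g - h, snd g) x" if "g \<in> germ_space" for g x
    using translate[of "snd g" "fst g" "x + h"] translate[of "snd g" "fst g - h" x] that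
    by (simp add: algebra_simps germ_space_def mem_Times_iff)
  moreover have "(fst g - h, snd g) \<in> germ_space \<longleftrightarrow> g \<in> germ_space" for g
    by (simp add: germ_space_def mem_Times_iff)
  ultimately show ?thesis by (simp add: early_def cong: conj_cong)
qed

text \<open>By monotonicity in the birth time and continuity in space, the set is a countable union of
  rectangles \<open>B \<times> {s. A (\<cdot>, s) x < t on B}\<close> over a basis of the topology.\<close>

lemma sublevel_sets: "{g \<in> germ_space. A g x < t} \<in> sets intensity"
proof -
  obtain \<B> :: "(real ^ 'd) set set" where \<B>: "countable \<B>" "topological_basis \<B>"
    using ex_countable_basis by blast
  \<comment> \<open>\<open>max 0\<close> extends the condition constantly to negative
    \<open>s\<close>, where nothing is known about \<open>A\<close>; this makes \<open>T B\<close>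
    downward closed in the whole line.\<close>
  define T where "T B = {s. \<forall>y\<in>B. A (y, max 0 s) x < t}" for B
  have T: "T B \<in> sets borel" for B
  proof (rule downward_closed_borel)
    fix s s' assume *: "s' \<in> T B" "s \<le> s'"
    have "A (y, max 0 s) x \<le> A (y, max 0 s') x" for y
      using mono[of "max 0 s" "max 0 s'" "x - y"] * by (simp add: translate[of "max 0 _" y])
    with * show "s \<in> T B" unfolding T_def using le_less_trans by blast
  qed
  have "{g \<in> germ_space. A g x < t} = (\<Union>B\<in>\<B>. B \<times> (T B \<inter> {0..}))"
  proof safe
    fix y s assume g: "(y, s) \<in> germ_space" "A (y, s) x < t"
    then have s: "s \<ge> 0" by (simp add: germ_space_def)
    \<comment> \<open>Continuity is given in the observation point; \<open>translate\<close> turns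
      it into continuity in the germ's location.\<close>
    have "continuous_on UNIV (\<lambda>z. A (0, s) (x - z))"
      by (intro continuous_on_compose2[OF cont[OF s]] continuous_intros) auto
    then have "open {z. A (0, s) (x - z) < t}"
      by (intro open_Collect_less continuous_intros)
    then have "open {z. A (z, s) x < t}" by (simp only: translate[OF s, symmetric])
    then obtain B where B: "B \<in> \<B>" "y \<in> B" "B \<subseteq> {z. A (z, s) x < t}"
      using topological_basisE[OF \<B>(2), of _ y] g(2) by blast
    then have "s \<in> T B" using s by (auto simp: T_def)
    with B s show "(y, s) \<in> (\<Union>B\<in>\<B>. B \<times> (T B \<inter> {0..}))" by auto
  qed (auto simp: T_def germ_space_def)
  also have "\<dots> \<in> sets intensity"
  proof (rule sets.countable_UN'[OF \<B>(1)])
    have "B \<times> (T B \<inter> {0..}) \<in> sets intensity" if "B \<in> \<B>" for B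
      using topological_basis_open[OF \<B>(2) that] T by (intro pair_measureI borel_imp_sets_m) auto
    then show "(\<lambda>B. B \<times> (T B \<inter> {0..})) ` \<B> \<subseteq> sets intensity" by blast
  qed
  finally show ?thesis .
qed

lemma early_sets:
  assumes "finite F"
  shows "early F \<in> sets intensity"
proof -
  have "early F = (\<Union>p\<in>F. {g \<in> germ_space. A g (fst p) < snd p})" by (auto simp: early_def)
  then show ?thesis using assms sublevel_sets by auto
qed

text \<open>If \<open>A (y, s) x < t\<close>, linear growth gives
  \<open>s + norm (x - y) / M < t\<close>, which bounds the birth time by \<open>t\<close> and the
  distance of \<open>y\<close> from \<open>x\<close> by \<open>M * t\<close>.\<close>

lemma early_bounded:
  assumes "finite F"
  obtains R where "R > 0" "early F \<subseteq> cball 0 R \<times> {0..R}"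
proof -
  \<comment> \<open>The summand of \<open>p\<close> covers both its location bound and its time
    bound. The leading 1 keeps \<open>R\<close> positive for empty \<open>F\<close>, so that
    \<open>m_finite\<close> applies to \<open>{0..R}\<close>.\<close>
  define R where "R = 1 + (\<Sum>p\<in>F. norm (fst p) + M * \<bar>snd p\<bar> + \<bar>snd p\<bar>)"
  have "g \<in> cball 0 R \<times> {0..R}" if gF: "g \<in> early F" for g
  proof -
    obtain y s where g: "g = (y, s)" by fastforce
    have s: "s \<ge> 0" using gF early_subset g by (auto simp: germ_space_def)
    obtain p where p: "p \<in> F" "A (y, s) (fst p) < snd p"
      using gF unfolding g early_def by blast
    have "norm (fst p) + M * \<bar>snd p\<bar> + \<bar>snd p\<bar> \<le> (\<Sum>p\<in>F. norm (fst p) + M * \<bar>snd p\<bar> + \<bar>snd p\<bar>)"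
      using assms p(1) M_pos by (intro member_le_sum) auto
    then have R: "norm (fst p) + M * \<bar>snd p\<bar> + \<bar>snd p\<bar> \<le> R" by (simp add: R_def)
    have *: "s + norm (fst p - y) / M < snd p"
      using growth[OF s, of "fst p - y"] p(2) translate[OF s, of y "fst p"] by simp
    then have "norm (fst p - y) / M < snd p" using s by linarith
    then have "norm (fst p - y) < M * snd p"
      using M_pos by (simp add: pos_divide_less_eq mult.commute)
    moreover have "norm y \<le> norm (fst p) + norm (fst p - y)"
      using norm_triangle_ineq4[of "fst p" "fst p - y"] by simp
    moreover have "M * snd p \<le> M * \<bar>snd p\<bar>" using M_pos by simp
    moreover have "norm (fst p - y) / M \<ge> 0" "M * \<bar>snd p\<bar> \<ge> 0" using M_pos by simp_all
    ultimately have "norm y \<le> R" "s \<le> R"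
      using R * abs_ge_self[of "snd p"] norm_ge_zero[of "fst p"] by linarith+
    then show ?thesis using s by (simp add: g)
  qed
  moreover have "R > 0"
    unfolding R_def using M_pos by (intro add_pos_nonneg sum_nonneg) auto
  ultimately show thesis using that by blast
qed

lemma emeasure_early_finite:
  assumes "finite F"
  shows "emeasure intensity (early F) < \<infinity>"
proof -
  obtain R where R: "R > 0" "early F \<subseteq> cball 0 R \<times> {0..R}" using early_bounded[OF assms] .
  have I: "{0..R} \<in> sets m"
    using borel_imp_sets_m[of "{0..R}"] by (simp add: Int_absorb2 subset_iff)
  have "emeasure intensity (early F) \<le> emeasure intensity (cball 0 R \<times> {0..R})"
    using R I by (intro emeasure_mono pair_measureI) auto
  also have "\<dots> = emeasure lborel (cball 0 R :: (real ^ 'd) set) * emeasure m {0..R}"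
    using I by (intro m.emeasure_pair_measure_Times) auto
  also have "\<dots> < \<infinity>"
    using m_finite[OF R(1)] emeasure_bounded_finite[of "cball 0 R :: (real ^ 'd) set"]
    by (simp add: ennreal_mult_less_top)
  finally show ?thesis .
qed

text \<open>Fubini over the birth time: for fixed \<open>s\<close> the spatial slice is translated
  by \<open>h\<close>, and Lebesgue measure does not change.\<close>

lemma emeasure_early_shift:
  assumes "finite F"
  shows "emeasure intensity (early ((\<lambda>p. (fst p + h, snd p)) ` F)) = emeasure intensity (early F)"
proof -
  have "emeasure lborel ((\<lambda>y. (y, s)) -` early ((\<lambda>p. (fst p + h, snd p)) ` F))
      = emeasure lborel ((\<lambda>y. (y, s)) -` early F)" (is "emeasure _ ?L = emeasure _ ?R") for s
  proof -
    have R: "?R \<in> sets borel"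
      using sets_Pair2[OF early_sets[OF assms], of s] by simp
    have "?L = (+) (- h) -` ?R"
      by (use early_subset in \<open>auto simp: early_shift germ_space_def\<close>)
    then have "emeasure lborel ?L = emeasure (distr lborel borel ((+) (- h))) ?R"
      using R by (subst emeasure_distr) auto
    then show ?thesis by (simp add: lborel_distr_plus)
  qed
  then show ?thesis
    using pair.emeasure_pair_measure_alt2[OF early_sets[OF assms]]
      pair.emeasure_pair_measure_alt2[OF early_sets[of "(\<lambda>p. (fst p + h, snd p)) ` F"]] assms
    by simp
qed

lemma early_shift_disjoint:
  assumes "finite F" "finite F'"
  shows "\<forall>\<^sub>F h in at_infinity. early F \<inter> early ((\<lambda>p. (fst p + h, snd p)) ` F') = {}"
proof -
  obtain R R' where R: "early F \<subseteq> cball 0 R \<times> {0..R}" "early F' \<subseteq> cball 0 R' \<times> {0..R'}"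
    using early_bounded assms by metis
  show ?thesis unfolding eventually_at_infinity
  \<comment> \<open>A common germ would force \<open>norm h \<le> R + R'\<close> by the triangle
    inequality; the \<open>+ 1\<close> turns this into a contradiction.\<close>
  proof (intro exI[of _ "R + R' + 1"] allI impI equals0I)
    fix h g assume h: "R + R' + 1 \<le> norm h"
      and "g \<in> early F \<inter> early ((\<lambda>p. (fst p + h, snd p)) ` F')"
    then have "norm (fst g) \<le> R" "norm (fst g - h) \<le> R'" using R by (auto simp: early_shift)
    then show False using h norm_triangle_ineq4[of "fst g" "fst g - h"] by simp
  qed
qed

text \<open>An infimum is at least \<open>t\<close> exactly when every member is, attained or not.
  Real \<open>Inf\<close> obeys this for nonempty sets bounded below, and \<open>nonneg\<close>
  provides the bound 0.\<close>

lemma field_ge_iff: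
  assumes "N \<omega> \<subseteq> germ_space" "N \<omega> \<noteq> {}"
  shows "crystal_field A N \<omega> \<in> upper_orthant F \<longleftrightarrow> N \<omega> \<inter> early F = {}"
proof -
  have "bdd_below ((\<lambda>g. A g x) ` N \<omega>)" for x
    using assms(1) nonneg by (intro bdd_belowI[of _ 0]) auto
  then have "t \<le> crystal_field A N \<omega> x \<longleftrightarrow> (\<forall>g\<in>N \<omega>. t \<le> A g x)" for t x
    using assms(2) by (simp add: crystal_field_def le_cINF_iff)
  then show ?thesis
    using assms(1) by (force simp: upper_orthant_def early_def not_less)
qed

section \<open>The law of the field of a Poisson process of germs\<close>

context
  fixes \<Omega> :: "'w measure" and N :: "'w \<Rightarrow> ((real ^ 'd) \<times> real) set"
  assumes N: "poisson_point_process \<Omega> intensity N"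
begin

lemma prob_space: "prob_space \<Omega>"
  using N by (simp add: poisson_point_process_def)

lemma germs: "\<omega> \<in> space \<Omega> \<Longrightarrow> N \<omega> \<subseteq> germ_space"
  using N by (auto simp: poisson_point_process_def space_intensity)

text \<open>Measurability is not a statement up to null sets, so outcomes without germs are treated
  separately: there the field is the constant \<open>Inf {}\<close>.\<close>

lemma measurable_crystal_field: "crystal_field A N \<in> measurable \<Omega> field_algebra"
proof -
  have [measurable]: "{\<omega> \<in> space \<Omega>. N \<omega> = {}} \<in> sets \<Omega>"
  proof -
    have "{\<omega> \<in> space \<Omega>. N \<omega> = {}} = {\<omega> \<in> space \<Omega>. N \<omega> \<inter> space intensity = {}}"
      using germs by (auto simp: space_intensity)
    then show ?thesis using poisson_void_sets[OF N sets.top] by simp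
  qed
  have "(\<lambda>\<omega>. crystal_field A N \<omega> x) \<in> borel_measurable \<Omega>" for x
    unfolding borel_measurable_iff_ge
  proof
    fix a
    have [measurable]: "{\<omega> \<in> space \<Omega>. N \<omega> \<inter> early {(x, a)} = {}} \<in> sets \<Omega>"
      using poisson_void_sets[OF N early_sets] by simp
    have "a \<le> crystal_field A N \<omega> x \<longleftrightarrow>
        (if N \<omega> = {} then a \<le> Inf {} else N \<omega> \<inter> early {(x, a)} = {})" if "\<omega> \<in> space \<Omega>" for \<omega>
      using field_ge_iff[where F = "{(x, a)}" and N = N, OF germs[OF that]]
      by (simp add: upper_orthant_def crystal_field_def)
    then have "{\<omega> \<in> space \<Omega>. a \<le> crystal_field A N \<omega> x} = {\<omega> \<in> space \<Omega>.
        if N \<omega> = {} then a \<le> Inf {} else N \<omega> \<inter> early {(x, a)} = {}}" by blast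
    also have "\<dots> \<in> sets \<Omega>" by measurable
    finally show "{\<omega> \<in> space \<Omega>. a \<le> crystal_field A N \<omega> x} \<in> sets \<Omega>" .
  qed
  then have "(\<lambda>\<omega> x. crystal_field A N \<omega> x) \<in> measurable \<Omega> field_algebra"
    by (rule measurable_PiM_single') (auto simp: PiE_UNIV_domain)
  then show ?thesis .
qed

definition law :: "((real ^ 'd) \<Rightarrow> real) measure" where
  "law = distr \<Omega> field_algebra (crystal_field A N)"

lemma prob_space_law: "prob_space law"
  unfolding law_def using prob_space measurable_crystal_field by (rule prob_space.prob_space_distr)

lemma law_upper_orthant:
  assumes F: "finite F"
  shows "measure law (upper_orthant F) = exp (- measure intensity (early F))"
proof -
  interpret prob_space \<Omega> by (rule prob_space)
  have "measure law (upper_orthant F)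
      = prob (crystal_field A N -` upper_orthant F \<inter> space \<Omega>)"
    unfolding law_def using measurable_crystal_field upper_orthant_sets[OF F] by (rule measure_distr)
  also have "\<dots> = prob {\<omega> \<in> space \<Omega>. N \<omega> \<inter> early F = {}}"
  \<comment> \<open>The two events can differ only where \<open>N \<omega>\<close> is empty, which
    has probability 0.\<close>
  proof (rule finite_measure_eq_AE)
    show "AE \<omega> in \<Omega>. \<omega> \<in> crystal_field A N -` upper_orthant F \<inter> space \<Omega> \<longleftrightarrow>
        \<omega> \<in> {\<omega> \<in> space \<Omega>. N \<omega> \<inter> early F = {}}"
      using poisson_AE_nonempty[OF N emeasure_intensity_space]
      by eventually_elim (use field_ge_iff[where N = N] germs in auto)
    show "crystal_field A N -` upper_orthant F \<inter> space \<Omega> \<in> events"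
      using measurable_crystal_field upper_orthant_sets[OF F] by (rule measurable_sets)
    show "{\<omega> \<in> space \<Omega>. N \<omega> \<inter> early F = {}} \<in> events"
      using N early_sets[OF F] by (rule poisson_void_sets)
  qed
  also have "\<dots> = exp (- measure intensity (early F))"
    using N early_sets[OF F] emeasure_early_finite[OF F] by (rule poisson_void_probability)
  finally show ?thesis .
qed

text \<open>Stationarity on the generating class: the probability depends only on the intensity of
  \<open>early F\<close>, which is invariant under shifts.\<close>

lemma law_upper_orthant_shift:
  assumes "finite F"
  shows "measure law (field_shift h -` upper_orthant F) = measure law (upper_orthant F)"
  using assms
  by (simp add: field_shift_vimage_upper_orthant law_upper_orthant measure_def[of intensity]
    emeasure_early_shift)

text \<open>The intersection is again an orthant, so its probability is a single exponential. Once
  the two early sets are disjoint their intensities add, and the exponential splits into the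
  product.\<close>

lemma law_upper_orthant_factorises:
  assumes F: "finite F" "finite F'"
  shows "\<forall>\<^sub>F h in at_infinity. measure law (upper_orthant F \<inter> field_shift h -` upper_orthant F')
      = measure law (upper_orthant F) * measure law (upper_orthant F')"
  using early_shift_disjoint[OF F]
proof eventually_elim
  case (elim h)
  let ?F' = "(\<lambda>p. (fst p + h, snd p)) ` F'"
  have F'': "finite ?F'" using F(2) by (rule finite_imageI)
  have "measure intensity (early F \<union> early ?F')
      = measure intensity (early F) + measure intensity (early ?F')"
    using elim emeasure_early_finite[OF F(1)] emeasure_early_finite[OF F'']
    by (intro measure_Union early_sets F(1) F'') auto
  moreover have "measure intensity (early ?F') = measure intensity (early F')"
    by (simp only: measure_def[of intensity] emeasure_early_shift[OF F(2)])
  moreover have "measure law (upper_orthant F \<inter> field_shift h -` upper_orthant F')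
      = exp (- measure intensity (early F \<union> early ?F'))"
    unfolding field_shift_vimage_upper_orthant upper_orthant_Un[symmetric] early_Un[symmetric]
    using F(1) F'' by (intro law_upper_orthant finite_UnI)
  ultimately show ?case
    by (simp only: law_upper_orthant[OF F(1)] law_upper_orthant[OF F(2)] mult_exp_exp
      minus_add_distrib)
qed

lemma mixing_crystal_field: "mixing_field \<Omega> (crystal_field A N)"
proof -
  interpret law: prob_space law by (rule prob_space_law)
  let ?G = "upper_orthant ` Collect finite :: ((real ^ 'd) \<Rightarrow> real) set set"
  have sets_law: "sets law = sets field_algebra" and space_law: "space law = UNIV"
    by (simp_all add: law_def)
  have "((\<lambda>h. measure law (X \<inter> (field_shift h -` Y \<inter> space law)))
      \<longlongrightarrow> measure law X * measure law Y) at_infinity"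
    if "X \<in> sets field_algebra" "Y \<in> sets field_algebra" for X Y
  proof (rule law.mixing_from_pi_system[where G = ?G and T = field_shift])
    show "field_shift h \<in> measurable law law" for h
      unfolding measurable_cong_sets[OF sets_law sets_law] by (rule measurable_field_shift)
    show "measure law (field_shift h -` Y \<inter> space law) = measure law Y" if Y: "Y \<in> ?G" for h Y
    proof -
      obtain F where F: "finite F" "Y = upper_orthant F" using Y by blast
      show ?thesis unfolding F(2) space_law Int_UNIV_right
        using F(1) by (rule law_upper_orthant_shift)
    qed
    show "((\<lambda>h. measure law (X \<inter> (field_shift h -` Y \<inter> space law)))
        \<longlongrightarrow> measure law X * measure law Y) at_infinity" if XY: "X \<in> ?G" "Y \<in> ?G" for X Y
    proof -
      obtain F F' where F: "finite F" "finite F'" "X = upper_orthant F" "Y = upper_orthant F'"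
        using XY by blast
      show ?thesis unfolding space_law Int_UNIV_right F(3,4)
        using F(1,2) by (intro tendsto_eventually law_upper_orthant_factorises)
    qed
    show "sets law = sigma_sets (space law) ?G"
      unfolding sets_law space_law by (rule sets_field_algebra_eq)
    show "Int_stable ?G" by (rule Int_stable_upper_orthants)
    show "?G \<subseteq> Pow (space law)" unfolding space_law by blast
    show "X \<in> sets law" "Y \<in> sets law" using that unfolding sets_law .
  \<comment> \<open>Index types are nonempty, so \<open>real ^ 'd\<close> has vectors of arbitrarily
    large norm and the filter is proper; this is where the dimension being at least 1
    enters.\<close>
  qed (rule trivial_limit_at_infinity)
  then show ?thesis
    unfolding mixing_field_def Let_def law_def[symmetric] space_law Int_UNIV_right
    by (intro conjI ballI measurable_crystal_field)
qed

end

end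

section \<open>From the assumptions on crystals to the hypotheses of the locale\<close>

theorem theorem1:
  fixes A :: "(real ^ 'd) \<times> real \<Rightarrow> real ^ 'd \<Rightarrow> real"
    and m :: "real measure"
    and \<Omega> :: "'w measure"
    and N :: "'w \<Rightarrow> ((real ^ 'd) \<times> real) set"
  assumes m_sets: "sets m = sets (restrict_space borel {0..})"
    and m_finite: "\<forall>a>0. emeasure m {0..a} < \<infinity>"
    and m_nonzero: "emeasure m {0..} \<noteq> 0"
    and N: "poisson_point_process \<Omega> (lborel \<Otimes>\<^sub>M m) N"
    and A_nonneg: "\<forall>g\<in>germ_space. \<forall>x. 0 \<le> A g x"
    and A1: "\<forall>g\<in>germ_space. \<forall>x. A g x = A (0, snd g) (x - fst g)"
    and A2: "\<forall>g\<in>germ_space. A g (fst g) = snd g \<and> (\<forall>x. snd g \<le> A g x)"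
    and A3: "\<forall>g\<in>germ_space. (\<forall>t\<ge>0. bounded (free_crystal A g t) \<and> convex (free_crystal A g t))
               \<and> (\<forall>s t. 0 \<le> s \<and> s < t \<longrightarrow> free_crystal A g s \<subseteq> free_crystal A g t)"
    and A4: "\<forall>g\<in>germ_space. continuous_on UNIV (A g)
               \<and> (\<forall>t\<ge>0. frontier (free_crystal A g t) = {x. A g x = t})"
    and A5: "\<exists>M>0. \<forall>t\<ge>0. \<forall>x. t + 1 / M * norm x \<le> A (0, t) x"
    and A6: "\<forall>t0\<ge>0. \<forall>r>0. \<exists>t>0. cball 0 r \<subseteq> free_crystal A (0, t0) t"
    and A7: "\<forall>g\<in>germ_space. \<forall>g1\<in>epigraph UNIV (A g). \<forall>x. A g x \<le> A g1 x"
  shows "mixing_field \<Omega> (crystal_field A N)"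
proof -
  obtain M where M: "M > 0" "\<And>t x. t \<ge> 0 \<Longrightarrow> t + 1 / M * norm x \<le> A (0, t) x"
    using A5 by auto
  \<comment> \<open>By \<open>A2\<close> the crystal born at \<open>(0, s)\<close> takes the value
    \<open>s\<close> at 0, so \<open>(0, t)\<close> lies in its epigraph, and \<open>A7\<close>
    compares the two.\<close>
  have mono: "A (0, s) x \<le> A (0, t) x" if "0 \<le> s" "s \<le> t" for s t x
  proof -
    have g: "(0, s) \<in> germ_space" using that by (simp add: germ_space_def)
    have "(0, t) \<in> epigraph UNIV (A (0, s))"
      using bspec[OF A2 g] that by (simp add: mem_epigraph)
    then show ?thesis by (rule A7[rule_format, OF g])
  qed
  interpret crystal_growth A m M
  proof
    show "A (y, s) x = A (0, s) (x - y)" if "s \<ge> 0" for y s x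
      using bspec[OF A1, of "(y, s)"] that by (simp add: germ_space_def)
    show "continuous_on UNIV (A (0, s))" if "s \<ge> 0" for s
      using bspec[OF A4, of "(0, s)"] that by (simp add: germ_space_def)
    show "0 \<le> A g x" if "g \<in> germ_space" for g x
      using that by (rule A_nonneg[rule_format])
  qed (fact m_sets m_finite[rule_format] m_nonzero M mono)+
  show ?thesis using N by (rule mixing_crystal_field)
qed

end
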